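(* Let $\mathfrak g$ be of type $C_\ell$, $\ell\ge2$, let $\Psi=\Psi(i_1,\dots,i_k)$, $1\le i_1<\dots<i_k\le\ell$, and suppose that $\Psi$ is regular. Let $\lambda\in P^+$ and assume that $|\lambda^+\cup\lambda^-|>0$. Then the connected component $\Delta_\Psi[\lambda]$ of $\Delta_\Psi$ containing $\lambda$ is isomorphic to the quiver $\Xi_a(\boldsymbol m)$, where $\boldsymbol m=(m_1,\dots,m_k)\in(\mathbb Z_+\cup\{+\infty\})^k$, $m_r=\lambda(h_{i_r-1})+\lambda(h_{i_r})$ for $1\le r\le k$, and $a\in\{0,1\}$, $a=\lambda(h_{i_1})+\dots+\lambda(h_{i_k})\pmod 2$.
   Context: $\mathfrak g$ is the simple complex Lie algebra of type $C_\ell$ with root system $R$, weight lattice $P$, dominant weights $P^+$, simple roots $\alpha_i$, fundamental weights $\varpi_i$ and simple coroots $h_i$, $i\in I=\{1,\dots,\ell\}$ ($\alpha_\ell$ is long). Convention: $\lambda(h_0)=+\infty$ for $\lambda\in P^+$, and $+\infty+n=+\infty$ for $n\in\mathbb Z_+$. Set $\beta_{i,j}=\beta_{j,i}=\sum_{r=i}^{\ell-1}\alpha_r+\sum_{r=j}^{\ell-1}\alpha_r+\alpha_\ell$, $1\le i\le j\le\ell$; so $\beta_{i,j}=\varpi_i+\varpi_j-\varpi_{i-1}-\varpi_{j-1}$ with $\varpi_0=0$. $\Psi(i_1,\dots,i_k)=\{\beta_{i_r,i_s}:1\le r\le s\le k\}$ (these are exactly the extremal sets of positive roots, i.e. the sets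 of roots in $R^+$ of the form $\{\alpha\in R:(\xi,\alpha)=\max_{\beta\in R}(\xi,\beta)\}$, $\xi\in P$). For $\beta\in R^+$ let $\varepsilon_i(\beta)=\max\{t\in\mathbb Z_+:\beta+t\alpha_i\in R\}$, $\varepsilon(\beta)=\sum_i\varepsilon_i(\beta)\varpi_i$. The quiver $\Delta_\Psi$ has vertex set $P^+$ and an arrow $\lambda\leftarrow\lambda+\beta$ for each $\lambda,\lambda+\beta\in P^+$, $\beta\in\Psi$, with $\lambda-\varepsilon(\beta)\in P^+$. For a vertex $x$, $x^+$ (resp. $x^-$) is the set of $y$ with an arrow $y\leftarrow x$ (resp. $x\leftarrow y$). For $\eta\in\Psi+\Psi$, $m_\eta=\#\{(\beta,\beta')\in\Psi\times\Psi:\beta+\beta'=\eta\}$ and $t_{\lambda,\eta}$ is the number of paths from $\lambda+\eta$ to $\lambda$ in $\Delta_\Psi$ ($0$ if $\lambda+\eta\notin P^+$). $\Psi$ is regular if $t_{\lambda,\eta}>0$ implies $t_{\lambda,\eta}=m_\eta$ for all $\lambda\in P^+$, $\eta\in\Psi+\Psi$. For $\boldsymbol m\in(\mathbb Z_+\cup\{+\infty\})^k$ the quiver $\Xi(\boldsymbol m)$ has vertices $\boldsymbol x=(x_1,\dots,x_k)\in\mathbb Z_+^k$ with $x_i\le m_i$ for all $i$, and arrows $\boldsymbol x\leftarrow\boldsymbol x+2\boldsymbol e_j$ whenever $x_j<m_j-1$, and $\boldsymbol x\leftarrow\boldsymbol x+\boldsymbol e_j+\boldsymbol e_l$ whenever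 $j<l$, $x_j<m_j$, $x_l<m_l$ (here $\boldsymbol e_j$ are the standard unit vectors). $\Xi_a(\boldsymbol m)$ is the full subquiver on the vertices $\boldsymbol x$ with $x_1+\dots+x_k\equiv a\pmod2$. *)

theory Defs
  imports
    "HOL-Library.Function_Algebras"
    "HOL-Library.Extended_Nat"
    "HOL-Number_Theory.Cong"
    "Graph_Theory.Graph_Theory"
begin

section \<open>Root data of type C\<close>

text \<open>
  The usual coordinates for type \<open>C\<^sub>l\<close> are used.  With \<open>\<epsilon>\<^sub>1, \<dots>, \<epsilon>\<^sub>l\<close> an orthonormal basis,
  the weight lattice is \<open>\<int>\<epsilon>\<^sub>1 \<oplus> \<dots> \<oplus> \<int>\<epsilon>\<^sub>l\<close>, the simple roots are \<open>\<epsilon>\<^sub>i - \<epsilon>\<^sub>i\<^sub>+\<^sub>1\<close> for \<open>i < l\<close> and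
  \<open>2\<epsilon>\<^sub>l\<close>, and the fundamental weights are \<open>\<epsilon>\<^sub>1 + \<dots> + \<epsilon>\<^sub>i\<close>.  A weight is the function of its
  coordinates, vanishing outside \<open>{1..l}\<close>.
\<close>

type_synonym weight = "nat \<Rightarrow> int"

definition zscale :: "int \<Rightarrow> weight \<Rightarrow> weight" where
  "zscale c v = (\<lambda>j. c * v j)"

definition eps_vec :: "nat \<Rightarrow> weight" where
  "eps_vec i = (\<lambda>j. if j = i then 1 else 0)"

definition inner_prod :: "nat \<Rightarrow> weight \<Rightarrow> weight \<Rightarrow> int" where
  "inner_prod l v w = (\<Sum>j=1..l. v j * w j)"

definition weights :: "nat \<Rightarrow> weight set" where
  "weights l = {v. \<forall>j. j \<notin> {1..l} \<longrightarrow> v j = 0}"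

definition roots :: "nat \<Rightarrow> weight set" where
  "roots l =
     {zscale s (eps_vec i) + zscale t (eps_vec j) | i j s t.
        1 \<le> i \<and> i < j \<and> j \<le> l \<and> s \<in> {1, -1} \<and> t \<in> {1, -1}}
     \<union> {zscale s (zscale 2 (eps_vec i)) | i s. 1 \<le> i \<and> i \<le> l \<and> s \<in> {1, -1}}"

definition simple_root :: "nat \<Rightarrow> nat \<Rightarrow> weight" where
  "simple_root l i = (if i = l then zscale 2 (eps_vec l) else eps_vec i - eps_vec (i + 1))"

definition fund_weight :: "nat \<Rightarrow> weight" where
  "fund_weight i = (\<Sum>j=1..i. eps_vec j)"

text \<open>
  \<open>coroot_val l v i\<close> is \<open>v(h\<^sub>i) = 2(v,\<alpha>\<^sub>i)/(\<alpha>\<^sub>i,\<alpha>\<^sub>i)\<close>; the division is exact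
  (see \<open>coroot_val_exact\<close> below).
\<close>

definition coroot_val :: "nat \<Rightarrow> weight \<Rightarrow> nat \<Rightarrow> int" where
  "coroot_val l v i =
     2 * inner_prod l v (simple_root l i) div inner_prod l (simple_root l i) (simple_root l i)"

definition dominant_weights :: "nat \<Rightarrow> weight set" where
  "dominant_weights l = {v \<in> weights l. \<forall>i\<in>{1..l}. 0 \<le> coroot_val l v i}"

text \<open>The convention \<open>\<lambda>(h\<^sub>0) = +\<infinity>\<close>; only meant for dominant weights.\<close>

definition coroot_val_ext :: "nat \<Rightarrow> weight \<Rightarrow> nat \<Rightarrow> enat" where
  "coroot_val_ext l v i = (if i = 0 then \<infinity> else enat (nat (coroot_val l v i)))"

definition beta :: "nat \<Rightarrow> nat \<Rightarrow> nat \<Rightarrow> weight" where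
  "beta l i j = (\<Sum>r=i..<l. simple_root l r) + (\<Sum>r=j..<l. simple_root l r) + simple_root l l"

definition Psi :: "nat \<Rightarrow> nat \<Rightarrow> (nat \<Rightarrow> nat) \<Rightarrow> weight set" where
  "Psi l k \<iota> = {beta l (\<iota> r) (\<iota> s) | r s. 1 \<le> r \<and> r \<le> s \<and> s \<le> k}"

definition string_len :: "nat \<Rightarrow> nat \<Rightarrow> weight \<Rightarrow> nat" where
  "string_len l i b = Max {t::nat. b + zscale (int t) (simple_root l i) \<in> roots l}"

definition string_weight :: "nat \<Rightarrow> weight \<Rightarrow> weight" where
  "string_weight l b = (\<Sum>i=1..l. zscale (int (string_len l i b)) (fund_weight i))"

subsection \<open>Consistency of the coordinates\<close>

lemma inner_prod_eps:
  "i \<in> {1..l} \<Longrightarrow> inner_prod l v (eps_vec i) = v i"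
  by (simp add: inner_prod_def eps_vec_def if_distrib cong: if_cong)

lemma inner_prod_simple_root:
  assumes "i \<in> {1..l}"
  shows "inner_prod l v (simple_root l i) = (if i = l then 2 * v l else v i - v (i + 1))"
proof (cases "i = l")
  case True
  have "inner_prod l v (zscale 2 (eps_vec l)) = 2 * inner_prod l v (eps_vec l)"
    by (simp add: inner_prod_def zscale_def sum_distrib_left algebra_simps)
  then show ?thesis using True assms by (simp add: simple_root_def inner_prod_eps)
next
  case False
  have "inner_prod l v (eps_vec i - eps_vec (i + 1))
        = inner_prod l v (eps_vec i) - inner_prod l v (eps_vec (i + 1))"
    by (simp add: inner_prod_def sum_subtractf algebra_simps)
  then show ?thesis using False assms by (simp add: simple_root_def inner_prod_eps)
qed

lemma inner_prod_simple_root_self: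
  assumes "i \<in> {1..l}"
  shows "inner_prod l (simple_root l i) (simple_root l i) = (if i = l then 4 else 2)"
  unfolding inner_prod_simple_root[OF assms]
  by (auto simp: simple_root_def zscale_def eps_vec_def)

lemma coroot_val_eq:
  assumes "i \<in> {1..l}"
  shows "coroot_val l v i = (if i = l then v l else v i - v (i + 1))"
  unfolding coroot_val_def inner_prod_simple_root_self[OF assms]
  unfolding inner_prod_simple_root[OF assms] by auto

lemma coroot_val_exact:
  assumes "i \<in> {1..l}"
  shows "coroot_val l v i * inner_prod l (simple_root l i) (simple_root l i)
         = 2 * inner_prod l v (simple_root l i)"
  unfolding coroot_val_eq[OF assms] inner_prod_simple_root_self[OF assms]
  unfolding inner_prod_simple_root[OF assms] by auto

lemma fund_weight_apply: "fund_weight i j = (if 1 \<le> j \<and> j \<le> i then 1 else 0)"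
  by (induction i) (auto simp: fund_weight_def eps_vec_def)

lemma coroot_val_fund_weight:
  assumes "i \<in> {1..l}" "j \<in> {1..l}"
  shows "coroot_val l (fund_weight j) i = (if i = j then 1 else 0)"
  using assms by (auto simp: coroot_val_eq fund_weight_apply)

lemma cartan_matrix:
  assumes "i \<in> {1..l}" "j \<in> {1..l}"
  shows "coroot_val l (simple_root l j) i =
    (if i = j then 2 else if i + 1 = j \<and> j = l then -2
     else if i + 1 = j \<or> j + 1 = i then -1 else 0)"
  using assms by (auto simp: coroot_val_eq simple_root_def zscale_def eps_vec_def)

lemma sum_simple_roots:
  assumes "i \<le> l"
  shows "(\<Sum>r=i..<l. simple_root l r) = eps_vec i - eps_vec l"
proof -
  have "(\<Sum>r=i..<l. simple_root l r) = (\<Sum>r=i..<l. eps_vec r - eps_vec (Suc r))"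
    by (rule sum.cong) (auto simp: simple_root_def)
  also have "\<dots> = eps_vec i - eps_vec l"
    using sum_Suc_diff'[OF assms, of "\<lambda>r. - eps_vec r"] by simp
  finally show ?thesis .
qed

lemma beta_eq_eps:
  assumes "i \<in> {1..l}" "j \<in> {1..l}"
  shows "beta l i j = eps_vec i + eps_vec j"
  using assms by (simp add: beta_def sum_simple_roots)
    (auto simp: simple_root_def zscale_def fun_eq_iff)

lemma beta_eq_fund_weight:
  assumes "i \<in> {1..l}" "j \<in> {1..l}"
  shows "beta l i j = fund_weight i + fund_weight j - fund_weight (i - 1) - fund_weight (j - 1)"
  using assms unfolding beta_eq_eps[OF assms]
  by (auto simp: fun_eq_iff fund_weight_apply eps_vec_def)

section \<open>Quivers\<close>

text \<open>
  All quivers here have at most one arrow between two vertices, so the arrows are the pairs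
  (source, target): the arrow \<open>x \<leftarrow> y\<close> is \<open>(y, x)\<close>.
\<close>

type_synonym 'a quiver = "('a, 'a \<times> 'a) pre_digraph"

definition out_nbrs :: "'a quiver \<Rightarrow> 'a \<Rightarrow> 'a set" where
  "out_nbrs Q x = {y. x \<rightarrow>\<^bsub>Q\<^esub> y}"

definition in_nbrs :: "'a quiver \<Rightarrow> 'a \<Rightarrow> 'a set" where
  "in_nbrs Q x = {y. y \<rightarrow>\<^bsub>Q\<^esub> x}"

definition conn_component :: "'a quiver \<Rightarrow> 'a \<Rightarrow> 'a quiver" where
  "conn_component Q x = Q \<restriction> {y. x \<rightarrow>\<^sup>*\<^bsub>with_proj (mk_symmetric Q)\<^esub> y}"

definition Delta :: "nat \<Rightarrow> weight set \<Rightarrow> weight quiver" where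
  "Delta l \<Psi> = with_proj \<lparr>
     pverts = dominant_weights l,
     parcs = {(v + b, v) | v b.
        v \<in> dominant_weights l \<and> v + b \<in> dominant_weights l \<and> b \<in> \<Psi>
        \<and> v - string_weight l b \<in> dominant_weights l} \<rparr>"

definition pair_count :: "weight set \<Rightarrow> weight \<Rightarrow> nat" where
  "pair_count \<Psi> \<eta> = card {(b, b'). b \<in> \<Psi> \<and> b' \<in> \<Psi> \<and> b + b' = \<eta>}"

text \<open>
  \<open>awalk\<close> requires its initial vertex to be a vertex of the quiver, so the count below is 0
  if \<open>v + \<eta>\<close> is not dominant.  For \<open>\<Psi>\<close> as above the set counted is finite: every
  \<open>beta l i j\<close> has coordinate sum 2, so all its walks have the same length.
\<close>

definition path_count :: "nat \<Rightarrow> weight set \<Rightarrow> weight \<Rightarrow> weight \<Rightarrow> nat" where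
  "path_count l \<Psi> v \<eta> = card {p. pre_digraph.awalk (Delta l \<Psi>) (v + \<eta>) p v}"

definition regular_set :: "nat \<Rightarrow> weight set \<Rightarrow> bool" where
  "regular_set l \<Psi> \<longleftrightarrow>
     (\<forall>v\<in>dominant_weights l. \<forall>\<eta>\<in>{b + b' | b b'. b \<in> \<Psi> \<and> b' \<in> \<Psi>}.
        path_count l \<Psi> v \<eta> > 0 \<longrightarrow> path_count l \<Psi> v \<eta> = pair_count \<Psi> \<eta>)"

text \<open>
  Elements of \<open>\<nat>\<^sup>k\<close> are functions vanishing outside \<open>{1..k}\<close>; only the values of \<open>m\<close> on
  \<open>{1..k}\<close> matter.  The condition \<open>x\<^sub>j < m\<^sub>j - 1\<close> is written \<open>x\<^sub>j + 1 < m\<^sub>j\<close> to avoid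
  truncated subtraction.
\<close>

definition unit_vec :: "nat \<Rightarrow> nat \<Rightarrow> nat" where
  "unit_vec i = (\<lambda>j. if j = i then 1 else 0)"

definition Xi_verts :: "nat \<Rightarrow> (nat \<Rightarrow> enat) \<Rightarrow> (nat \<Rightarrow> nat) set" where
  "Xi_verts k m =
     {x. (\<forall>i. i \<notin> {1..k} \<longrightarrow> x i = 0) \<and> (\<forall>i\<in>{1..k}. enat (x i) \<le> m i)}"

definition Xi :: "nat \<Rightarrow> (nat \<Rightarrow> enat) \<Rightarrow> (nat \<Rightarrow> nat) quiver" where
  "Xi k m = with_proj \<lparr>
     pverts = Xi_verts k m,
     parcs =
       {(x + unit_vec j + unit_vec j, x) | x j.
          x \<in> Xi_verts k m \<and> j \<in> {1..k} \<and> enat (x j + 1) < m j}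
       \<union> {(x + unit_vec j + unit_vec n, x) | x j n.
          x \<in> Xi_verts k m \<and> j \<in> {1..k} \<and> n \<in> {1..k} \<and> j < n
          \<and> enat (x j) < m j \<and> enat (x n) < m n} \<rparr>"

definition Xi_parity :: "nat \<Rightarrow> (nat \<Rightarrow> enat) \<Rightarrow> nat \<Rightarrow> (nat \<Rightarrow> nat) quiver" where
  "Xi_parity k m a = Xi k m \<restriction> {x \<in> Xi_verts k m. [(\<Sum>i=1..k. x i) = a] (mod 2)}"

end

theory Submission
  imports Defs
begin

text \<open>
  Write \<open>J = {i\<^sub>1, \<dots>, i\<^sub>k}\<close>.  Regularity forbids two consecutive indices in \<open>J\<close>.  Once there are none, the
  condition \<open>\<lambda> - \<epsilon>(\<beta>) \<in> P\<^sup>+\<close> on an arrow follows from the dominance of \<open>\<lambda>\<close> and \<open>\<lambda> + \<beta>\<close>: the arrows are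
  all the moves by \<open>\<epsilon>\<^sub>i + \<epsilon>\<^sub>j\<close>, \<open>i, j \<in> J\<close>, between dominant weights.  Such a move keeps the coordinates
  outside \<open>J\<close>, hence each sum \<open>v(h\<^bsub>i-1\<^esub>) + v(h\<^sub>i)\<close>, \<open>i \<in> J\<close>, and dominance only says that
  \<open>0 \<le> v(h\<^sub>i) \<le> m\<^sub>r\<close> for \<open>i = i\<^sub>r\<close>.  So \<open>v \<mapsto> (v(h\<^sub>i))\<^sub>i\<^sub>\<in>\<^sub>J\<close> identifies the weights agreeing with \<open>\<lambda>\<close> outside \<open>J\<close>
  with \<open>\<Xi>(m)\<close>.  The parity of the coordinate sum is preserved by all arrows, and
  each \<open>\<Xi>\<^sub>a(m)\<close> with at least one arrow is connected.
\<close>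

section \<open>Dominant weights and root strings\<close>

text \<open>As \<open>v (Suc l) = 0\<close>, the value \<open>v l\<close> at the long coroot is also
  \<open>v l - v (Suc l)\<close>, so one inequality covers all \<open>j\<close>, including
  \<open>j = l\<close>.\<close>

lemma dominant_weights_iff:
  "v \<in> dominant_weights l \<longleftrightarrow>
    (\<forall>j. j \<notin> {1..l} \<longrightarrow> v j = 0) \<and> (\<forall>j\<in>{1..l}. v (Suc j) \<le> v j)"
proof -
  have "coroot_val l v i = v i - v (Suc i)" if "i \<in> {1..l}" "\<forall>j. j \<notin> {1..l} \<longrightarrow> v j = 0" for i
    using that by (auto simp: coroot_val_eq)
  then show ?thesis
    by (auto simp: dominant_weights_def weights_def)
qed

lemma coroot_val_dominant:
  assumes "v \<in> dominant_weights l" "i \<in> {1..l}"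
  shows "coroot_val l v i = v i - v (Suc i)"
  using assms by (auto simp: coroot_val_eq dominant_weights_iff)

section \<open>Root strings through \<open>eps_vec i + eps_vec j\<close>\<close>

lemma sum_abs_root:
  assumes "u \<in> roots l"
  shows "(\<Sum>j=1..l. \<bar>u j\<bar>) = 2"
proof -
  from assms consider
    (short) i j s t where "1 \<le> i" "i < j" "j \<le> l" "s \<in> {1, -1}" "t \<in> {1, -1}"
      "u = zscale s (eps_vec i) + zscale t (eps_vec j)"
  | (long) i s where "1 \<le> i" "i \<le> l" "s \<in> {1, -1}" "u = zscale s (zscale 2 (eps_vec i))"
    unfolding roots_def by blast
  then show ?thesis
  proof cases
    case short
    then have "\<bar>u n\<bar> = (if n = i then 1 else 0) + (if n = j then 1 else 0)" for n
      by (auto simp: zscale_def eps_vec_def)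
    then show ?thesis using short by (simp add: sum.distrib)
  next
    case long
    then have "\<bar>u n\<bar> = (if n = i then 2 else 0)" for n
      by (auto simp: zscale_def eps_vec_def)
    then show ?thesis using long by simp
  qed
qed

lemma eps_sum_root:
  assumes "i \<in> {1..l}" "j \<in> {1..l}"
  shows "eps_vec i + eps_vec j \<in> roots l"
proof (cases "i = j")
  case True
  then have "eps_vec i + eps_vec j = zscale 1 (zscale 2 (eps_vec i))"
    by (auto simp: zscale_def)
  then show ?thesis using assms unfolding roots_def by auto
next
  case False
  have "eps_vec i + eps_vec j = zscale 1 (eps_vec (min i j)) + zscale 1 (eps_vec (max i j))"
    by (auto simp: zscale_def min_def max_def)
  moreover have "1 \<le> min i j" "min i j < max i j" "max i j \<le> l"
    using assms False by auto
  ultimately show ?thesis unfolding roots_def by blast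
qed

text \<open>For \<open>p < l\<close>, adding the simple root turns one
  \<open>eps_vec (Suc p)\<close> into \<open>eps_vec p\<close>, once per occurrence. Any further
  step, and any step for \<open>p = l\<close>, violates the absolute coordinate sum 2 shared by long
  and short roots.\<close>

lemma string_len_eps_sum:
  assumes "i \<in> {1..l}" "j \<in> {1..l}" "p \<in> {1..l}"
  shows "string_len l p (eps_vec i + eps_vec j) = (if i = Suc p then 1 else 0) + (if j = Suc p then 1 else 0)"
    (is "_ = ?n")
  unfolding string_len_def
proof (rule Max_eqI)
  let ?b = "eps_vec i + eps_vec j"
  let ?T = "{t. ?b + zscale (int t) (simple_root l p) \<in> roots l}"
  show bound: "t \<le> ?n" if "t \<in> ?T" for t
  proof -
    let ?u = "?b + zscale (int t) (simple_root l p)"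
    have two: "(\<Sum>j=1..l. \<bar>?u j\<bar>) = 2" using that sum_abs_root by blast
    show ?thesis
    proof (cases "p = l")
      case True
      have "\<bar>?u n\<bar> = (if n = i then 1 else 0) + (if n = j then 1 else 0) + (if n = l then 2 * int t else 0)" for n
        using True by (auto simp: simple_root_def zscale_def eps_vec_def)
      with two have "2 * int t = 0" using assms by (simp add: sum.distrib)
      then show ?thesis by simp
    next
      case False
      \<comment> \<open>The last term corrects coordinate \<open>Suc p\<close>: the first two terms
        already contribute \<open>?n\<close> there, while its absolute value is that of
        \<open>?n - t\<close>.\<close>
      have "\<bar>?u n\<bar> = (if n = i then 1 else 0) + (if n = j then 1 else 0) + (if n = p then int t else 0)
          + (if n = Suc p then \<bar>int ?n - int t\<bar> - int ?n else 0)" for n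
        using False by (auto simp: simple_root_def zscale_def eps_vec_def)
      with two have "int t + \<bar>int ?n - int t\<bar> - int ?n = 0" using assms False by (simp add: sum.distrib)
      then show ?thesis by linarith
    qed
  qed
  then show "finite ?T" by (meson finite_nat_set_iff_bounded_le)
  have "?b + zscale (int ?n) (simple_root l p)
      = eps_vec (if i = Suc p then p else i) + eps_vec (if j = Suc p then p else j)"
    using assms by (auto simp: simple_root_def zscale_def eps_vec_def fun_eq_iff)
  also have "\<dots> \<in> roots l" using assms by (intro eps_sum_root) auto
  finally show "?n \<in> ?T" by simp
qed

text \<open>Only \<open>p = i - 1\<close> and \<open>p = j - 1\<close> contribute. For
  \<open>i = 1\<close> there is no such \<open>p\<close>, in agreement with
  \<open>fund_weight 0 = 0\<close>.\<close>

lemma string_weight_eps_sum: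
  assumes "i \<in> {1..l}" "j \<in> {1..l}"
  shows "string_weight l (eps_vec i + eps_vec j) = fund_weight (i - 1) + fund_weight (j - 1)"
proof -
  have eval_sum: "(\<Sum>p\<in>A. g p) q = (\<Sum>p\<in>A. g p q)" for g :: "nat \<Rightarrow> weight" and A q
    by (induction A rule: infinite_finite_induct) auto
  have fund: "(\<Sum>p=1..l. if i = Suc p then fund_weight p q else 0) = fund_weight (i - 1) q"
    if "i \<in> {1..l}" for i q
  proof (cases "i = 1")
    case False
    then have "(\<Sum>p=1..l. if i = Suc p then fund_weight p q else 0)
        = (\<Sum>p=1..l. if p = i - 1 then fund_weight p q else 0)"
      by (intro sum.cong) auto
    then show ?thesis using that False by auto
  qed (auto simp: fund_weight_apply)
  have "string_weight l (eps_vec i + eps_vec j) q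
      = (\<Sum>p=1..l. (if i = Suc p then fund_weight p q else 0) + (if j = Suc p then fund_weight p q else 0))" for q
    unfolding string_weight_def eval_sum
    by (intro sum.cong) (use assms in \<open>auto simp: string_len_eps_sum zscale_def\<close>)
  then show ?thesis
    by (intro ext) (simp only: sum.distrib fund[OF assms(1)] fund[OF assms(2)] plus_fun_apply)
qed

text \<open>Subtracting \<open>fund_weight (i - 1)\<close> lowers only the value at
  \<open>h_{i-1}\<close>, by one. Since \<open>p \<ge> 1\<close>, the test \<open>i = Suc p\<close>
  gives no condition for \<open>i = 1\<close>.\<close>

lemma dominant_minus_fund_weights_iff:
  assumes "v \<in> dominant_weights l" "i \<in> {1..l}" "j \<in> {1..l}"
  shows "v - (fund_weight (i - 1) + fund_weight (j - 1)) \<in> dominant_weights l \<longleftrightarrow>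
    (\<forall>p\<in>{1..l}. (if i = Suc p then 1 else 0) + (if j = Suc p then 1 else 0) \<le> v p - v (Suc p))"
    (is "?u \<in> _ \<longleftrightarrow> _")
proof -
  have "fund_weight (i - 1) p - fund_weight (i - 1) (Suc p) = (if i = Suc p then 1 else 0)"
    if "p \<in> {1..l}" for i p
    using that by (auto simp: fund_weight_apply)
  then have "?u p - ?u (Suc p) =
      v p - v (Suc p) - ((if i = Suc p then 1 else 0) + (if j = Suc p then 1 else 0))"
    if "p \<in> {1..l}" for p
    using that by (auto simp: algebra_simps)
  then have "?u (Suc p) \<le> ?u p \<longleftrightarrow>
      (if i = Suc p then 1 else 0) + (if j = Suc p then 1 else 0) \<le> v p - v (Suc p)"
    if "p \<in> {1..l}" for p
    using that by (metis (no_types, lifting) diff_ge_0_iff_ge)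
  moreover have "?u p = 0" if "p \<notin> {1..l}" for p
    using assms that by (auto simp: dominant_weights_iff fund_weight_apply)
  ultimately show ?thesis
    unfolding dominant_weights_iff[of ?u] by auto
qed

section \<open>Arrows of \<open>\<Delta>\<^sub>\<Psi>\<close>\<close>

lemma Psi_eq:
  assumes "\<iota> ` {1..k} \<subseteq> {1..l}"
  shows "Psi l k \<iota> = {eps_vec i + eps_vec j | i j. i \<in> \<iota> ` {1..k} \<and> j \<in> \<iota> ` {1..k}}"
proof -
  have beta: "beta l (\<iota> r) (\<iota> s) = eps_vec (\<iota> r) + eps_vec (\<iota> s)" if "r \<in> {1..k}" "s \<in> {1..k}" for r s
    using assms that by (intro beta_eq_eps) (auto simp: image_subset_iff)
  show ?thesis
  proof (intro equalityI subsetI)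
    fix b assume "b \<in> Psi l k \<iota>"
    then show "b \<in> {eps_vec i + eps_vec j | i j. i \<in> \<iota> ` {1..k} \<and> j \<in> \<iota> ` {1..k}}"
      using beta by (force simp: Psi_def)
  next
    fix b assume "b \<in> {eps_vec i + eps_vec j | i j. i \<in> \<iota> ` {1..k} \<and> j \<in> \<iota> ` {1..k}}"
    then obtain r s where rs: "r \<in> {1..k}" "s \<in> {1..k}" "b = eps_vec (\<iota> r) + eps_vec (\<iota> s)"
      by auto
    then have "b = beta l (\<iota> (min r s)) (\<iota> (max r s))"
      using beta by (auto simp: min_def max_def add.commute)
    moreover have "1 \<le> min r s" "min r s \<le> max r s" "max r s \<le> k" using rs by auto
    ultimately show "b \<in> Psi l k \<iota>" unfolding Psi_def by blast
  qed
qed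

lemma wf_Delta: "wf_digraph (Delta l \<Psi>)"
  by unfold_locales (auto simp: Delta_def)

text \<open>The arrows depend only on the set \<open>J\<close> of indices; their enumeration matters
  only for the comparison with \<open>Xi\<close>.\<close>

locale type_C_subset =
  fixes l :: nat and J :: "nat set" and \<Psi> :: "weight set"
  assumes J: "J \<subseteq> {1..l}"
    and Psi: "\<Psi> = {eps_vec i + eps_vec j | i j. i \<in> J \<and> j \<in> J}"
begin

text \<open>Among the coroot values, adding \<open>eps_vec i\<close> lowers only that at
  \<open>h_{i-1}\<close>, by one. Hence the inequalities that express dominance of
  \<open>v - string_weight l b\<close> also give dominance of \<open>v + b\<close>.\<close>

lemma Delta_arc_iff:
  "(w, v) \<in> arcs (Delta l \<Psi>) \<longleftrightarrow> v \<in> dominant_weights l \<and>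
    (\<exists>i\<in>J. \<exists>j\<in>J. w = v + (eps_vec i + eps_vec j) \<and>
      (\<forall>p\<in>{1..l}. (if i = Suc p then 1 else 0) + (if j = Suc p then 1 else 0) \<le> v p - v (Suc p)))"
    (is "?L \<longleftrightarrow> ?R")
proof
  assume ?L
  then obtain i j where ij: "i \<in> J" "j \<in> J" "v \<in> dominant_weights l" "w = v + (eps_vec i + eps_vec j)"
      "v - string_weight l (eps_vec i + eps_vec j) \<in> dominant_weights l"
    by (auto simp: Delta_def Psi)
  then have "i \<in> {1..l}" "j \<in> {1..l}" using J by auto
  with ij show ?R
    using dominant_minus_fund_weights_iff[of v l i j]
    by (simp only: string_weight_eps_sum) blast
next
  assume ?R
  then obtain i j where ij: "i \<in> J" "j \<in> J" "v \<in> dominant_weights l" "w = v + (eps_vec i + eps_vec j)"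
      and p: "\<forall>p\<in>{1..l}. (if i = Suc p then 1 else 0) + (if j = Suc p then 1 else 0) \<le> v p - v (Suc p)"
    by blast
  have il: "i \<in> {1..l}" "j \<in> {1..l}" using J ij by auto
  have "v - string_weight l (eps_vec i + eps_vec j) \<in> dominant_weights l"
    using dominant_minus_fund_weights_iff[of v l i j] ij il p by (simp only: string_weight_eps_sum)
  moreover have "w (Suc q) \<le> w q" if "q \<in> {1..l}" for q
    using bspec[OF p that] ij(4) by (auto simp: eps_vec_def split: if_splits)
  moreover have "w q = 0" if "q \<notin> {1..l}" for q
    using that ij il by (auto simp: dominant_weights_iff eps_vec_def)
  ultimately have "v - string_weight l (eps_vec i + eps_vec j) \<in> dominant_weights l" "w \<in> dominant_weights l"
    unfolding dominant_weights_iff[of w] by auto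
  then show ?L using ij by (auto simp: Delta_def Psi)
qed

section \<open>Walks, and the gap forced by regularity\<close>

lemma sum_awalk_Delta:
  assumes "pre_digraph.awalk (Delta l \<Psi>) w p v"
  shows "(\<Sum>j=1..l. w j) = (\<Sum>j=1..l. v j) + 2 * int (length p)"
  using assms
proof (induction p arbitrary: w)
  case Nil
  then show ?case by (simp add: wf_digraph.awalk_Nil_iff[OF wf_Delta])
next
  case (Cons e p)
  have tail_head: "tail (Delta l \<Psi>) = fst" "head (Delta l \<Psi>) = snd" by (auto simp: Delta_def)
  from Cons.prems have e: "e \<in> arcs (Delta l \<Psi>)" "w = fst e"
    "pre_digraph.awalk (Delta l \<Psi>) (snd e) p v"
    by (auto simp: wf_digraph.awalk_Cons_iff[OF wf_Delta] tail_head)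
  then have "(w, snd e) \<in> arcs (Delta l \<Psi>)" by simp
  then obtain i j where ij: "i \<in> J" "j \<in> J" and w: "w = snd e + (eps_vec i + eps_vec j)"
    unfolding Delta_arc_iff by blast
  have "i \<in> {1..l}" "j \<in> {1..l}" using ij J by auto
  then have "(\<Sum>j=1..l. w j) = (\<Sum>j=1..l. snd e j) + 2"
    by (simp add: w sum.distrib eps_vec_def)
  then show ?case using Cons.IH[OF e(3)] by simp
qed

text \<open>
  If \<open>i\<close> and \<open>i + 1\<close> both occurred, there would be exactly one path from \<open>2\<varpi>\<^sub>i\<^sub>+\<^sub>1\<close> to \<open>2\<varpi>\<^sub>i\<^sub>-\<^sub>1\<close>, through
  \<open>2\<varpi>\<^sub>i\<close>, although the two orders of the summands in \<open>2\<epsilon>\<^sub>i + 2\<epsilon>\<^sub>i\<^sub>+\<^sub>1\<close> already give \<open>m\<^sub>\<eta> \<ge> 2\<close>.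
\<close>
lemma regular_set_gap:
  assumes reg: "regular_set l \<Psi>" and i: "i \<in> J"
  shows "Suc i \<notin> J"
proof
  assume si: "Suc i \<in> J"
  define f where "f n = zscale 2 (fund_weight n)" for n
  define \<eta> where "\<eta> = (eps_vec i + eps_vec i) + (eps_vec (Suc i) + eps_vec (Suc i))"
  have il: "1 \<le> i" "Suc i \<le> l" using J i si by auto
  have f: "f n p = (if 1 \<le> p \<and> p \<le> n then 2 else 0)" for n p
    by (auto simp: f_def zscale_def fund_weight_apply)
  have dom: "f n \<in> dominant_weights l" if "n \<le> l" for n
    using that by (auto simp: dominant_weights_iff f)
  have u: "f i = f (i - 1) + (eps_vec i + eps_vec i)"
    and w: "f (Suc i) = f i + (eps_vec (Suc i) + eps_vec (Suc i))"
    and eta: "f (i - 1) + \<eta> = f (Suc i)"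
    using il by (auto simp: fun_eq_iff f eps_vec_def \<eta>_def)
  have "f (i - 1) \<in> dominant_weights l" "f i \<in> dominant_weights l"
    using il by (auto intro: dom)
  moreover have "\<forall>p\<in>{1..l}. (if i = Suc p then 1 else 0) + (if i = Suc p then 1 else 0)
      \<le> f (i - 1) p - f (i - 1) (Suc p)"
    and "\<forall>p\<in>{1..l}. (if Suc i = Suc p then 1 else 0) + (if Suc i = Suc p then 1 else 0)
      \<le> f i p - f i (Suc p)"
    by (auto simp: f)
  ultimately have arcs: "(f i, f (i - 1)) \<in> arcs (Delta l \<Psi>)" "(f (Suc i), f i) \<in> arcs (Delta l \<Psi>)"
    unfolding Delta_arc_iff using u w i si by blast+
  have tail_head: "tail (Delta l \<Psi>) = fst" "head (Delta l \<Psi>) = snd" by (auto simp: Delta_def)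
  have verts: "f (i - 1) \<in> verts (Delta l \<Psi>)" using dom[of "i - 1"] il by (auto simp: Delta_def)
  have "{p. pre_digraph.awalk (Delta l \<Psi>) (f (i - 1) + \<eta>) p (f (i - 1))}
      = {[(f (Suc i), f i), (f i, f (i - 1))]}" (is "?W = {?p}")
  proof (intro equalityI subsetI)
    fix p assume "p \<in> ?W"
    then have p: "pre_digraph.awalk (Delta l \<Psi>) (f (Suc i)) p (f (i - 1))" using eta by simp
    \<comment> \<open>Each arrow lowers the coordinate sum by 2, so a walk covering the difference
      \<open>\<eta>\<close> has exactly two arrows.\<close>
    have "(\<Sum>j=1..l. \<eta> j) = 4"
      using il by (simp add: \<eta>_def eps_vec_def sum.distrib flip: sum_distrib_left)
    then have "length p = 2"
      using sum_awalk_Delta[OF p] unfolding eta[symmetric] by (simp add: sum.distrib)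
    then obtain e1 e2 where p_eq: "p = [e1, e2]"
      by (auto simp: numeral_2_eq_2 length_Suc_conv)
    obtain u' where e: "e1 = (f (Suc i), u')" "e2 = (u', f (i - 1))"
      and a: "(f (Suc i), u') \<in> arcs (Delta l \<Psi>)" "(u', f (i - 1)) \<in> arcs (Delta l \<Psi>)"
      using p unfolding p_eq
      by (cases e1; cases e2) (auto simp: wf_digraph.awalk_simps[OF wf_Delta] tail_head)
    obtain b1 b2 where b: "b1 \<in> J" "b2 \<in> J" "u' = f (i - 1) + (eps_vec b1 + eps_vec b2)"
      and str: "\<forall>p\<in>{1..l}. (if b1 = Suc p then 1 else 0) + (if b2 = Suc p then 1 else 0)
                  \<le> f (i - 1) p - f (i - 1) (Suc p)"
      using a(2) unfolding Delta_arc_iff by blast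
    obtain b3 b4 where "f (Suc i) = u' + (eps_vec b3 + eps_vec b4)"
      using a(1) unfolding Delta_arc_iff by blast
    then have "\<eta> = eps_vec b1 + eps_vec b2 + (eps_vec b3 + eps_vec b4)"
      unfolding eta[symmetric] b(3) by (simp add: add.assoc)
    then have "\<eta> q = eps_vec b1 q + eps_vec b2 q + (eps_vec b3 q + eps_vec b4 q)" for q
      by simp
    \<comment> \<open>All summands are nonnegative, so nothing cancels, and \<open>\<eta>\<close>
      vanishes outside \<open>{i, Suc i}\<close>.\<close>
    from this[of b1] this[of b2] have "b1 \<in> {i, Suc i}" "b2 \<in> {i, Suc i}"
      by (auto simp: \<eta>_def eps_vec_def split: if_splits)
    \<comment> \<open>The weight \<open>f (i - 1)\<close> has value 0 at \<open>h_i\<close>, so the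
      string condition at \<open>p = i\<close> forbids adding
      \<open>eps_vec (Suc i)\<close>.\<close>
    moreover have "b1 \<noteq> Suc i" "b2 \<noteq> Suc i"
      using bspec[OF str, of i] il by (auto simp: f split: if_splits)
    ultimately have "u' = f i" using b(3) u by simp
    then show "p \<in> {?p}" using p_eq e by simp
  next
    fix p assume "p \<in> {?p}"
    then show "p \<in> ?W"
      using arcs eta verts by (auto simp: wf_digraph.awalk_simps[OF wf_Delta] tail_head)
  qed
  then have one: "path_count l \<Psi> (f (i - 1)) \<eta> = 1"
    by (simp add: path_count_def)
  have in_Psi: "eps_vec i + eps_vec i \<in> \<Psi>" "eps_vec (Suc i) + eps_vec (Suc i) \<in> \<Psi>"
    unfolding Psi using i si by blast+
  have "f (i - 1) \<in> dominant_weights l" using il by (intro dom) auto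
  then have "pair_count \<Psi> \<eta> = 1"
    using reg in_Psi one unfolding regular_set_def \<eta>_def by (metis (mono_tags, lifting) mem_Collect_eq zero_less_one)
  moreover have "2 \<le> pair_count \<Psi> \<eta>"
  proof -
    let ?a = "eps_vec i + eps_vec i" and ?b = "eps_vec (Suc i) + eps_vec (Suc i)"
    let ?S = "{(b, b'). b \<in> \<Psi> \<and> b' \<in> \<Psi> \<and> b + b' = \<eta>}"
    have "finite J" using J finite_subset by blast
    then have "finite \<Psi>" unfolding Psi
      using finite_image_set2[of "\<lambda>i. i \<in> J" "\<lambda>j. j \<in> J"] by simp
    then have fin: "finite ?S" by (intro finite_subset[of ?S "\<Psi> \<times> \<Psi>"] finite_cartesian_product) auto
    have "?a i \<noteq> ?b i" by (simp add: eps_vec_def)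
    then have "?a \<noteq> ?b" by metis
    then have "card {(?a, ?b), (?b, ?a)} = 2" by simp
    moreover have "{(?a, ?b), (?b, ?a)} \<subseteq> ?S"
      using in_Psi by (auto simp: \<eta>_def add.commute)
    ultimately show ?thesis
      unfolding pair_count_def using card_mono[OF fin, of "{(?a, ?b), (?b, ?a)}"] by simp
  qed
  ultimately show False by simp
qed

text \<open>If \<open>Suc p \<in> J\<close>, then \<open>p \<notin> J\<close>, so coordinate
  \<open>p\<close> is unchanged. Dominance of \<open>w\<close> at \<open>p\<close> then says that
  \<open>v p - v (Suc p)\<close> is at least the number of copies of \<open>eps_vec (Suc p)\<close>
  added, which is the string condition.\<close>

lemma Delta_arc_iff_gap:
  assumes gap: "\<And>i. i \<in> J \<Longrightarrow> Suc i \<notin> J"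
  shows "(w, v) \<in> arcs (Delta l \<Psi>) \<longleftrightarrow> v \<in> dominant_weights l \<and> w \<in> dominant_weights l \<and>
    (\<exists>i\<in>J. \<exists>j\<in>J. w = v + (eps_vec i + eps_vec j))" (is "?L \<longleftrightarrow> ?R")
proof
  assume ?L
  moreover from this have "w \<in> dominant_weights l" by (auto simp: Delta_def)
  ultimately show ?R unfolding Delta_arc_iff by blast
next
  assume ?R
  then obtain i j where ij: "i \<in> J" "j \<in> J" "w = v + (eps_vec i + eps_vec j)"
    and dom: "v \<in> dominant_weights l" "w \<in> dominant_weights l" by blast
  have "(if i = Suc p then 1 else 0) + (if j = Suc p then 1 else 0) \<le> v p - v (Suc p)"
    if p: "p \<in> {1..l}" for p
  proof (cases "Suc p \<in> J")
    case True
    then have "p \<notin> J" using gap by blast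
    then have "w p = v p" using ij by (auto simp: eps_vec_def)
    moreover have "w (Suc p) \<le> w p" using dom p by (auto simp: dominant_weights_iff)
    ultimately show ?thesis using ij by (auto simp: eps_vec_def split: if_splits)
  next
    case False
    then have "i \<noteq> Suc p" "j \<noteq> Suc p" using ij by auto
    then show ?thesis using dom p by (auto simp: dominant_weights_iff)
  qed
  then show ?L unfolding Delta_arc_iff using ij dom by blast
qed

end

section \<open>Connectedness\<close>

text \<open>Reachability with directions ignored, the relation behind
  \<open>conn_component\<close>.\<close>

abbreviation linked :: "'a quiver \<Rightarrow> 'a \<Rightarrow> 'a \<Rightarrow> bool" where
  "linked Q x y \<equiv> x \<rightarrow>\<^sup>*\<^bsub>with_proj (mk_symmetric Q)\<^esub> y"

lemma wf_mk_symmetric: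
  assumes "wf_digraph Q"
  shows "wf_digraph (with_proj (mk_symmetric Q))"
  using wf_digraph.wellformed_mk_symmetric[OF assms] by (simp add: wf_digraph_wp_iff)

lemma linked_trans:
  assumes "wf_digraph Q" "linked Q x y" "linked Q y z"
  shows "linked Q x z"
  using wf_digraph.reachable_trans[OF wf_mk_symmetric[OF assms(1)] assms(2,3)] .

lemma linked_sym: "linked Q x y \<Longrightarrow> linked Q y x"
  using symmetric_reachable[OF symmetric_mk_symmetric] .

lemma linked_adj:
  assumes "wf_digraph Q" "e \<in> arcs Q"
  shows "linked Q (tail Q e) (head Q e)"
  using assms by (intro wf_digraph.reachable_adjI[OF wf_mk_symmetric]) (auto simp: parcs_mk_symmetric)

text \<open>The image of \<open>f\<close> is connected because \<open>H\<close> is, and no arrow of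
  \<open>Q\<close> leaves or enters it, so it is the vertex set of the component. By
  \<open>arcs\<close>, \<open>f\<close> is then an isomorphism onto the induced subquiver.\<close>

lemma digraph_iso_conn_component:
  assumes wf: "wf_digraph Q" "wf_digraph H"
    and ends: "tail Q = fst" "head Q = snd" "tail H = fst" "head H = snd"
    and inj: "inj_on f (verts H)"
    and verts: "f ` verts H \<subseteq> verts Q"
    and arcs: "\<And>x y. x \<in> verts H \<Longrightarrow> y \<in> verts H \<Longrightarrow> (f y, f x) \<in> arcs Q \<longleftrightarrow> (y, x) \<in> arcs H"
    and closed: "\<And>w v. (w, v) \<in> arcs Q \<Longrightarrow> w \<in> f ` verts H \<longleftrightarrow> v \<in> f ` verts H"
    and conn: "\<And>x y. x \<in> verts H \<Longrightarrow> y \<in> verts H \<Longrightarrow> linked H x y"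
    and x0: "x0 \<in> verts H"
  shows "digraph_iso (conn_component Q (f x0)) H"
proof -
  have in_verts: "y \<in> verts H" "x \<in> verts H" if "(y, x) \<in> arcs H" for x y
    using wf_digraph.wellformed[OF wf(2) that] by (auto simp: ends)
  have "linked Q (f x) (f y)" if "linked H x y" for x y
    using that
  proof (induction rule: wf_digraph.reachable_induct[OF wf_mk_symmetric[OF wf(2)], consumes 1, case_names base step])
    case base
    then show ?case
      using verts by (intro wf_digraph.reachable_refl[OF wf_mk_symmetric[OF wf(1)]]) auto
  next
    case (step y z)
    then have "(y, z) \<in> arcs H \<or> (z, y) \<in> arcs H" by (auto simp: parcs_mk_symmetric ends)
    then have "linked Q (f y) (f z)"
    proof
      assume "(y, z) \<in> arcs H"
      then have "(f y, f z) \<in> arcs Q" using arcs in_verts by blast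
      from linked_adj[OF wf(1) this] show ?thesis by (simp add: ends)
    next
      assume "(z, y) \<in> arcs H"
      then have "(f z, f y) \<in> arcs Q" using arcs in_verts by blast
      from linked_adj[OF wf(1) this] show ?thesis by (simp add: ends linked_sym)
    qed
    with step.IH show ?case using linked_trans[OF wf(1)] by blast
  qed
  then have "linked Q (f x0) v" if "v \<in> f ` verts H" for v
    using that conn[OF x0] by blast
  moreover have "v \<in> f ` verts H" if "linked Q (f x0) v" for v
    using that
  proof (induction rule: wf_digraph.reachable_induct[OF wf_mk_symmetric[OF wf(1)], consumes 1, case_names base step])
    case base
    then show ?case using x0 by blast
  next
    case (step y z)
    then have "(y, z) \<in> arcs Q \<or> (z, y) \<in> arcs Q" by (auto simp: parcs_mk_symmetric ends)
    then show ?case using closed step.IH by blast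
  qed
  ultimately have comp: "conn_component Q (f x0) = Q \<restriction> (f ` verts H)"
    unfolding conn_component_def by (metis (mono_tags, lifting) Collect_cong Collect_mem_eq)
  \<comment> \<open>Arcs are pairs of vertices, so \<open>f\<close> acts on both entries; keeping
    \<open>fst\<close> and \<open>snd\<close> as projections makes the image of \<open>H\<close>
    equal to the induced subquiver.\<close>
  define hom where
    "hom = \<lparr>iso_verts = f, iso_arcs = map_prod f f, iso_head = snd, iso_tail = fst\<rparr>"
  have arcs_eq: "map_prod f f ` arcs H = {e \<in> arcs Q. fst e \<in> f ` verts H \<and> snd e \<in> f ` verts H}"
    (is "?A = ?B")
  proof (intro equalityI subsetI)
    fix e assume "e \<in> ?A"
    then obtain x y where yx: "(y, x) \<in> arcs H" "e = (f y, f x)" by auto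
    then show "e \<in> ?B" using arcs[OF in_verts(2,1)[OF yx(1)]] in_verts[OF yx(1)] by simp
  next
    fix e assume "e \<in> ?B"
    then obtain x y where "x \<in> verts H" "y \<in> verts H" "e = (f y, f x)" "e \<in> arcs Q"
      by (cases e) auto
    then have "(y, x) \<in> arcs H" "e = map_prod f f (y, x)" using arcs[of x y] by simp_all
    then show "e \<in> ?A" by (rule rev_image_eqI)
  qed
  have "inj_on (map_prod f f) (arcs H)"
    using map_prod_inj_on[OF inj inj] by (rule inj_on_subset) (use in_verts in auto)
  then have "pre_digraph.digraph_isomorphism H hom"
    using wf(2) inj by (auto simp: pre_digraph.digraph_isomorphism_def hom_def ends)
  moreover have "Q \<restriction> (f ` verts H) = app_iso hom H"
    by (rule pre_digraph.equality) (auto simp: hom_def ends arcs_eq)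
  ultimately have "digraph_iso H (Q \<restriction> (f ` verts H))"
    unfolding digraph_iso_def by blast
  then show ?thesis
    unfolding comp using wf(2) by (rule_tac digraph_iso_swap)
qed

section \<open>The quivers \<open>\<Xi>\<^sub>a(m)\<close>\<close>

text \<open>The strict inequalities in \<open>Xi\<close> are the bounds by \<open>m\<close> for the
  source \<open>y\<close>; the two kinds of arrows become the cases \<open>j = n\<close> and
  \<open>j \<noteq> n\<close>.\<close>

lemma Xi_arc_iff:
  "(y, x) \<in> arcs (Xi k m) \<longleftrightarrow> x \<in> Xi_verts k m \<and> y \<in> Xi_verts k m \<and>
    (\<exists>j\<in>{1..k}. \<exists>n\<in>{1..k}. y = x + unit_vec j + unit_vec n)" (is "?L \<longleftrightarrow> ?R")
proof
  assume ?L
  then consider (double) j where "x \<in> Xi_verts k m" "j \<in> {1..k}" "enat (Suc (x j)) < m j"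
      "y = x + unit_vec j + unit_vec j"
    | (single) j n where "x \<in> Xi_verts k m" "j \<in> {1..k}" "n \<in> {1..k}" "j < n"
      "enat (x j) < m j" "enat (x n) < m n" "y = x + unit_vec j + unit_vec n"
    by (auto simp: Xi_def)
  then show ?R
  proof cases
    case double
    have "enat (y i) \<le> m i" if "i \<in> {1..k}" for i
    proof (cases "i = j")
      case True
      then have "y i = Suc (Suc (x j))" using double(4) by (simp add: unit_vec_def)
      then show ?thesis using double(3) True by (simp add: Suc_ile_eq)
    next
      case False
      then have "y i = x i" using double(4) by (simp add: unit_vec_def)
      then show ?thesis using double(1) that by (simp add: Xi_verts_def)
    qed
    then have "y \<in> Xi_verts k m" using double by (auto simp: Xi_verts_def unit_vec_def)
    then show ?thesis using double by blast
  next
    case single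
    have "enat (y i) \<le> m i" if "i \<in> {1..k}" for i
    proof (cases "i = j \<or> i = n")
      case True
      then have "y i = Suc (x i)" using single(4,7) by (auto simp: unit_vec_def)
      then show ?thesis using single(5,6) True by (auto simp: Suc_ile_eq)
    next
      case False
      then have "y i = x i" using single(7) by (simp add: unit_vec_def)
      then show ?thesis using single(1) that by (simp add: Xi_verts_def)
    qed
    then have "y \<in> Xi_verts k m" using single by (auto simp: Xi_verts_def unit_vec_def)
    then show ?thesis using single by blast
  qed
next
  assume ?R
  then obtain j n where xy: "x \<in> Xi_verts k m" "y \<in> Xi_verts k m" and jn: "j \<in> {1..k}" "n \<in> {1..k}"
    "j \<le> n" "y = x + unit_vec j + unit_vec n"
    by (metis (no_types, lifting) add.commute add.left_commute nle_le)
  have "enat (y j) \<le> m j" "enat (y n) \<le> m n" using xy jn by (auto simp: Xi_verts_def)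
  then have "if j = n then enat (Suc (x j)) < m j else enat (x j) < m j \<and> enat (x n) < m n"
    using jn by (auto simp: unit_vec_def Suc_ile_eq)
  then show ?L using xy jn by (auto simp: Xi_def split: if_splits)
qed

lemma wf_Xi: "wf_digraph (Xi k m)"
proof
  fix e assume "e \<in> arcs (Xi k m)"
  then have "(fst e, snd e) \<in> arcs (Xi k m)" by simp
  then have "snd e \<in> Xi_verts k m" "fst e \<in> Xi_verts k m" unfolding Xi_arc_iff by blast+
  then show "tail (Xi k m) e \<in> verts (Xi k m)" "head (Xi k m) e \<in> verts (Xi k m)"
    by (auto simp: Xi_def)
qed

lemma wf_Xi_parity: "wf_digraph (Xi_parity k m a)"
  unfolding Xi_parity_def using wf_Xi by (rule wf_digraph.wellformed_induce_subgraph)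

lemma Xi_ends: "tail (Xi k m) = fst" "head (Xi k m) = snd"
  by (simp_all add: Xi_def)

lemma Xi_parity_ends: "tail (Xi_parity k m a) = fst" "head (Xi_parity k m a) = snd"
  by (simp_all add: Xi_parity_def Xi_ends)

lemma verts_Xi_parity: "verts (Xi_parity k m a) = {x \<in> Xi_verts k m. [(\<Sum>i=1..k. x i) = a] (mod 2)}"
  by (simp add: Xi_parity_def)

lemma sum_unit_vec: "j \<in> {1..k} \<Longrightarrow> (\<Sum>i=1..k. unit_vec j i) = 1"
  by (simp add: unit_vec_def)

lemma parity_add_unit_vecs:
  assumes "j \<in> {1..k}" "n \<in> {1..k}"
  shows "[(\<Sum>i=1..k. (x + unit_vec j + unit_vec n) i) = a] (mod 2) \<longleftrightarrow> [(\<Sum>i=1..k. x i) = a] (mod 2)"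
proof -
  have "(\<Sum>i=1..k. (x + unit_vec j + unit_vec n) i) = (\<Sum>i=1..k. x i) + 2"
    using assms by (simp add: sum.distrib sum_unit_vec del: One_nat_def)
  then show ?thesis by (simp only: cong_def mod_add_self2)
qed

text \<open>An arrow changes the coordinate sum by 2, so the parity condition on \<open>x\<close>
  carries over to \<open>y\<close>.\<close>

lemma Xi_parity_arc_iff:
  "(y, x) \<in> arcs (Xi_parity k m a) \<longleftrightarrow> x \<in> verts (Xi_parity k m a) \<and> y \<in> Xi_verts k m \<and>
    (\<exists>j\<in>{1..k}. \<exists>n\<in>{1..k}. y = x + unit_vec j + unit_vec n)"
proof -
  have "(y, x) \<in> arcs (Xi_parity k m a) \<longleftrightarrow>
      (y, x) \<in> arcs (Xi k m) \<and> [(\<Sum>i=1..k. x i) = a] (mod 2)"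
  proof -
    have "(y, x) \<in> arcs (Xi_parity k m a) \<longleftrightarrow> (y, x) \<in> arcs (Xi k m) \<and>
        x \<in> verts (Xi_parity k m a) \<and> y \<in> verts (Xi_parity k m a)"
      by (auto simp: Xi_parity_def Xi_ends)
    then show ?thesis
      unfolding Xi_arc_iff verts_Xi_parity using parity_add_unit_vecs by blast
  qed
  then show ?thesis unfolding Xi_arc_iff verts_Xi_parity by blast
qed

section \<open>Connectedness by descent to small vertices\<close>

lemma Xi_verts_down:
  assumes "x + u \<in> Xi_verts k m"
  shows "x \<in> Xi_verts k m"
proof -
  have "enat (x i) \<le> m i" if "i \<in> {1..k}" for i
  proof -
    have "enat (x i) \<le> enat ((x + u) i)" by simp
    also have "\<dots> \<le> m i" using assms that by (simp add: Xi_verts_def)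
    finally show ?thesis .
  qed
  then show ?thesis using assms by (auto simp: Xi_verts_def)
qed

lemma linked_Xi_parity_down:
  assumes "x + unit_vec j + unit_vec n \<in> verts (Xi_parity k m a)" "j \<in> {1..k}" "n \<in> {1..k}"
  shows "x \<in> verts (Xi_parity k m a)" "linked (Xi_parity k m a) (x + unit_vec j + unit_vec n) x"
proof -
  let ?y = "x + unit_vec j + unit_vec n"
  have y: "?y \<in> Xi_verts k m" using assms(1) by (simp add: verts_Xi_parity)
  then have "x \<in> Xi_verts k m" using Xi_verts_down by blast
  moreover have "[(\<Sum>i=1..k. x i) = a] (mod 2)"
    using assms(1) unfolding verts_Xi_parity mem_Collect_eq parity_add_unit_vecs[OF assms(2,3)] ..
  ultimately show x: "x \<in> verts (Xi_parity k m a)" by (simp add: verts_Xi_parity)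
  then have "(?y, x) \<in> arcs (Xi_parity k m a)" using y assms unfolding Xi_parity_arc_iff by blast
  from linked_adj[OF wf_Xi_parity this] show "linked (Xi_parity k m a) ?y x"
    by (simp add: Xi_parity_ends)
qed

lemma sum_pos_unit_vec:
  assumes "0 < (\<Sum>i=1..k. x i)"
  obtains j y where "j \<in> {1..k}" "x = y + unit_vec j"
proof -
  obtain j where "j \<in> {1..k}" "x j \<noteq> 0"
    using assms by (metis less_nat_zero_code sum.neutral)
  then have "x = x(j := x j - 1) + unit_vec j" by (auto simp: unit_vec_def fun_eq_iff)
  then show ?thesis using that \<open>j \<in> {1..k}\<close> by blast
qed

text \<open>The vertex set is closed downwards, so units can be removed two at a time until at most
  one remains.\<close>

lemma linked_Xi_parity_small:
  assumes "x \<in> verts (Xi_parity k m a)"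
  shows "\<exists>z\<in>verts (Xi_parity k m a). linked (Xi_parity k m a) x z \<and> (\<Sum>i=1..k. z i) \<le> 1"
  using assms
proof (induction "\<Sum>i=1..k. x i" arbitrary: x rule: less_induct)
  case less
  show ?case
  proof (cases "(\<Sum>i=1..k. x i) \<le> 1")
    case True
    then show ?thesis using less.prems
      by (intro bexI[of _ x] conjI wf_digraph.reachable_refl[OF wf_mk_symmetric[OF wf_Xi_parity]]) auto
  next
    case False
    then have "0 < (\<Sum>i=1..k. x i)" by simp
    then obtain j y where j: "j \<in> {1..k}" "x = y + unit_vec j" by (rule sum_pos_unit_vec)
    then have sx: "(\<Sum>i=1..k. x i) = (\<Sum>i=1..k. y i) + 1"
      by (simp add: sum.distrib sum_unit_vec del: One_nat_def)
    with False have "0 < (\<Sum>i=1..k. y i)" by linarith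
    then obtain n z where n: "n \<in> {1..k}" "y = z + unit_vec n" by (rule sum_pos_unit_vec)
    then have "(\<Sum>i=1..k. y i) = (\<Sum>i=1..k. z i) + 1"
      by (simp add: sum.distrib sum_unit_vec del: One_nat_def)
    with sx have "(\<Sum>i=1..k. z i) < (\<Sum>i=1..k. x i)" by simp
    moreover have z: "z \<in> verts (Xi_parity k m a)" "linked (Xi_parity k m a) x z"
      using linked_Xi_parity_down[of z n j] less.prems j n by auto
    ultimately show ?thesis using less.hyps linked_trans[OF wf_Xi_parity] by blast
  qed
qed

lemma sum_eq_zero_Xi:
  assumes "x \<in> Xi_verts k m" "(\<Sum>i=1..k. x i) = 0"
  shows "x = 0"
proof
  fix i show "x i = 0 i" using assms by (cases "i \<in> {1..k}") (auto simp: Xi_verts_def)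
qed

text \<open>
  The hypothesis \<open>arc\<close> rules out \<open>a = 1\<close>, \<open>m = e\<^sub>j + e\<^sub>n\<close>, where the quiver consists of two isolated
  vertices.  Otherwise two vertices \<open>e\<^sub>j\<close>, \<open>e\<^sub>n\<close> lie below a common vertex \<open>e\<^sub>j + e\<^sub>n + e\<^sub>p\<close>.
\<close>
lemma linked_Xi_parity:
  assumes "a \<in> {0, 1}" and arc: "arcs (Xi_parity k m a) \<noteq> {}"
    and x: "x \<in> verts (Xi_parity k m a)" and y: "y \<in> verts (Xi_parity k m a)"
  shows "linked (Xi_parity k m a) x y"
proof -
  let ?H = "Xi_parity k m a"
  obtain x' y' where xy': "x' \<in> verts ?H" "linked ?H x x'" "(\<Sum>i=1..k. x' i) \<le> 1"
      "y' \<in> verts ?H" "linked ?H y y'" "(\<Sum>i=1..k. y' i) \<le> 1"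
    using linked_Xi_parity_small[OF x] linked_Xi_parity_small[OF y] by blast
  have sum_eq: "(\<Sum>i=1..k. z i) = a" if "z \<in> verts ?H" "(\<Sum>i=1..k. z i) \<le> 1" for z
  proof (rule cong_less_modulus_unique_nat)
    show "[(\<Sum>i=1..k. z i) = a] (mod 2)" using that by (simp add: verts_Xi_parity)
    show "(\<Sum>i=1..k. z i) < 2" "a < 2" using that assms(1) by auto
  qed
  have in_V: "x' \<in> Xi_verts k m" "y' \<in> Xi_verts k m" using xy' by (auto simp: verts_Xi_parity)
  have "linked ?H x' y'"
  proof (cases "a = 0 \<or> x' = y'")
    case True
    then have "x' = y'"
      using sum_eq_zero_Xi[OF in_V(1)] sum_eq_zero_Xi[OF in_V(2)] sum_eq[OF xy'(1,3)] sum_eq[OF xy'(4,6)]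
      by auto
    moreover have "y' \<in> verts (with_proj (mk_symmetric ?H))" using xy'(4) by simp
    ultimately show ?thesis
      using wf_digraph.reachable_refl[OF wf_mk_symmetric[OF wf_Xi_parity]] by metis
  next
    case False
    then have a: "a = 1" using assms by simp
    have unit: "\<exists>j\<in>{1..k}. z = unit_vec j" if "z \<in> Xi_verts k m" "(\<Sum>i=1..k. z i) = 1" for z
    proof -
      have "0 < (\<Sum>i=1..k. z i)" using that by simp
      then obtain j u where j: "j \<in> {1..k}" "z = u + unit_vec j" by (rule sum_pos_unit_vec)
      then have "(\<Sum>i=1..k. u i) = 0"
        using that by (simp add: sum.distrib sum_unit_vec del: One_nat_def)
      moreover have "u \<in> Xi_verts k m" using that(1) unfolding j(2) by (rule Xi_verts_down)
      ultimately have "u = 0" by (rule sum_eq_zero_Xi[rotated])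
      then show ?thesis using j by auto
    qed
    obtain j n where jn: "j \<in> {1..k}" "n \<in> {1..k}" "x' = unit_vec j" "y' = unit_vec n"
      using unit[OF in_V(1)] unit[OF in_V(2)] sum_eq[OF xy'(1,3)] sum_eq[OF xy'(4,6)] a by auto
    then have "j \<noteq> n" using False by auto
    \<comment> \<open>The source \<open>w\<close> of any arrow has odd coordinate sum at least 3, so
      it exceeds \<open>unit_vec j + unit_vec n\<close> in some coordinate \<open>p\<close>.\<close>
    obtain v w where "(w, v) \<in> arcs ?H" using arc by auto
    then have w: "w \<in> Xi_verts k m" and "v \<in> verts ?H"
      and "\<exists>j\<in>{1..k}. \<exists>n\<in>{1..k}. w = v + unit_vec j + unit_vec n"
      unfolding Xi_parity_arc_iff by blast+
    then have "(\<Sum>i=1..k. w i) = (\<Sum>i=1..k. v i) + 2" "odd (\<Sum>i=1..k. v i)"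
      using a by (auto simp: sum.distrib sum_unit_vec verts_Xi_parity cong_def odd_iff_mod_2_eq_one
          simp del: One_nat_def)
    then have "3 \<le> (\<Sum>i=1..k. w i)" by (auto elim: oddE)
    moreover have "(\<Sum>i=1..k. (unit_vec j + unit_vec n) i) = 2"
      using jn by (simp add: sum.distrib sum_unit_vec del: One_nat_def)
    ultimately have "(\<Sum>i=1..k. (unit_vec j + unit_vec n) i) < (\<Sum>i=1..k. w i)" by linarith
    then obtain p where p: "p \<in> {1..k}" "(unit_vec j + unit_vec n) p < w p"
      by (meson not_le sum_mono)
    \<comment> \<open>At \<open>p\<close> the vector \<open>z\<close> is bounded by the vertex
      \<open>w\<close>, elsewhere by the maximum of the vertices \<open>x'\<close> and
      \<open>y'\<close>; so \<open>z\<close> is a vertex even if \<open>w\<close> does not dominate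
      it.\<close>
    define z where "z = unit_vec j + unit_vec n + unit_vec p"
    have "z \<in> Xi_verts k m"
    proof -
      have "enat (z i) \<le> m i" if i: "i \<in> {1..k}" for i
      proof (cases "i = p")
        case True
        then have "z i \<le> w i" using p by (auto simp: z_def unit_vec_def)
        moreover have "enat (w i) \<le> m i" using w i by (auto simp: Xi_verts_def)
        ultimately show ?thesis by (meson enat_ord_simps(1) order_trans)
      next
        case False
        then have "z i = max (x' i) (y' i)"
          using \<open>j \<noteq> n\<close> jn by (auto simp: z_def unit_vec_def)
        moreover have "enat (x' i) \<le> m i" "enat (y' i) \<le> m i" using in_V i by (auto simp: Xi_verts_def)
        ultimately show ?thesis by (simp add: max_def)
      qed
      then show ?thesis using jn p by (auto simp: Xi_verts_def z_def unit_vec_def)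
    qed
    moreover have "(\<Sum>i=1..k. z i) = 3"
      using jn p by (simp add: z_def sum.distrib sum_unit_vec del: One_nat_def)
    ultimately have z: "z \<in> verts ?H" using a by (simp add: verts_Xi_parity cong_def)
    have zx: "z = x' + unit_vec n + unit_vec p" and zy: "z = y' + unit_vec j + unit_vec p"
      using jn by (auto simp: z_def fun_eq_iff)
    have "linked ?H z x'"
      using linked_Xi_parity_down(2)[OF z[unfolded zx] jn(2) p(1)] unfolding zx[symmetric] .
    moreover have "linked ?H z y'"
      using linked_Xi_parity_down(2)[OF z[unfolded zy] jn(1) p(1)] unfolding zy[symmetric] .
    ultimately show ?thesis by (rule linked_trans[OF wf_Xi_parity linked_sym])
  qed
  then have "linked ?H x' y" by (rule linked_trans[OF wf_Xi_parity _ linked_sym[OF xy'(5)]])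
  then show ?thesis by (rule linked_trans[OF wf_Xi_parity xy'(2)])
qed

section \<open>The isomorphism\<close>

text \<open>In the sum of the two coroot values coordinate \<open>i\<close> cancels. For
  \<open>i = 1\<close> the convention at \<open>h_0\<close> makes the sum infinite.\<close>

lemma le_coroot_val_ext_sum_iff:
  assumes "v \<in> dominant_weights l" "i \<in> {1..l}"
  shows "enat n \<le> coroot_val_ext l v (i - 1) + coroot_val_ext l v i \<longleftrightarrow>
    i = 1 \<or> int n \<le> v (i - 1) - v (Suc i)"
proof (cases "i = 1")
  case False
  then have i: "i - 1 \<in> {1..l}" "Suc (i - 1) = i" using assms(2) by auto
  then have "v i \<le> v (i - 1)" "v (Suc i) \<le> v i"
    using assms unfolding dominant_weights_iff by metis+
  moreover have "coroot_val_ext l v (i - 1) = enat (nat (v (i - 1) - v i))"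
    "coroot_val_ext l v i = enat (nat (v i - v (Suc i)))"
    using i assms coroot_val_dominant[OF assms(1) i(1)]
    by (auto simp: coroot_val_ext_def coroot_val_dominant)
  ultimately show ?thesis using False by auto
qed (simp add: coroot_val_ext_def)

text \<open>
  On the component of \<open>\<lambda>\<close> only the coordinates at \<open>i\<^sub>1, \<dots>, i\<^sub>k\<close> vary.  Since no two of these are
  adjacent, the vertex \<open>v\<close> is determined by the numbers \<open>v(h\<^bsub>i\<^sub>r\<^esub>)\<close>, and \<open>weight_of\<close> recovers \<open>v\<close> from them.
\<close>
locale type_C_gap =
  fixes l k :: nat and \<iota> :: "nat \<Rightarrow> nat" and lam :: weight and m :: "nat \<Rightarrow> enat"
  assumes inj: "inj_on \<iota> {1..k}"
    and range: "\<iota> ` {1..k} \<subseteq> {1..l}"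
    and gap: "\<And>i. i \<in> \<iota> ` {1..k} \<Longrightarrow> Suc i \<notin> \<iota> ` {1..k}"
    and lam: "lam \<in> dominant_weights l"
    and m: "\<And>r. r \<in> {1..k} \<Longrightarrow> m r = coroot_val_ext l lam (\<iota> r - 1) + coroot_val_ext l lam (\<iota> r)"
begin

sublocale type_C_subset l "\<iota> ` {1..k}" "Psi l k \<iota>"
  by unfold_locales (fact range, rule Psi_eq[OF range])

lemma Delta_arc_iff_dominant:
  "(w, v) \<in> arcs (Delta l (Psi l k \<iota>)) \<longleftrightarrow> v \<in> dominant_weights l \<and> w \<in> dominant_weights l \<and>
    (\<exists>i\<in>\<iota> ` {1..k}. \<exists>j\<in>\<iota> ` {1..k}. w = v + (eps_vec i + eps_vec j))"
  by (rule Delta_arc_iff_gap) (rule gap)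

text \<open>By \<open>gap\<close>, coordinate \<open>Suc j\<close> is still that of
  \<open>lam\<close>, so the summand \<open>lam (Suc j)\<close> makes the entry of \<open>x\<close>
  the value at \<open>h_j\<close>. For \<open>j = l\<close> this summand is 0, as the long coroot
  requires.\<close>

definition weight_of :: "(nat \<Rightarrow> nat) \<Rightarrow> weight" where
  "weight_of x = (\<lambda>j. if j \<in> \<iota> ` {1..k} then lam (Suc j) + int (x (the_inv_into {1..k} \<iota> j)) else lam j)"

lemma weight_of_at: "r \<in> {1..k} \<Longrightarrow> weight_of x (\<iota> r) = lam (Suc (\<iota> r)) + int (x r)"
  by (simp add: weight_of_def the_inv_into_f_f[OF inj] del: One_nat_def)

lemma weight_of_off: "j \<notin> \<iota> ` {1..k} \<Longrightarrow> weight_of x j = lam j"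
  by (simp add: weight_of_def)

lemma iota_in: "r \<in> {1..k} \<Longrightarrow> \<iota> r \<in> {1..l}"
  using range by blast

lemma weight_eqI:
  assumes "\<And>r. r \<in> {1..k} \<Longrightarrow> v (\<iota> r) = w (\<iota> r)" "\<And>j. j \<notin> \<iota> ` {1..k} \<Longrightarrow> v j = w j"
  shows "v = w"
  using assms by (metis ext imageE)

text \<open>Agreement outside \<open>{1..k}\<close> is assumed instead of membership in
  \<open>Xi_verts\<close> so that \<open>x + unit_vec j + unit_vec n\<close> can be used before it
  is known to be a vertex.\<close>

lemma weight_of_inj:
  assumes "weight_of x = weight_of y" "\<And>i. i \<notin> {1..k} \<Longrightarrow> x i = y i"
  shows "x = y"
proof
  fix i show "x i = y i"
    using assms weight_of_at[of i x] weight_of_at[of i y] by (cases "i \<in> {1..k}") auto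
qed

lemma weight_of_add:
  assumes "j \<in> {1..k}" "n \<in> {1..k}"
  shows "weight_of (x + unit_vec j + unit_vec n) = weight_of x + (eps_vec (\<iota> j) + eps_vec (\<iota> n))"
proof (rule weight_eqI)
  fix r assume r: "r \<in> {1..k}"
  then have "\<iota> r = \<iota> j \<longleftrightarrow> r = j" "\<iota> r = \<iota> n \<longleftrightarrow> r = n"
    using inj assms by (meson inj_onD)+
  then show "weight_of (x + unit_vec j + unit_vec n) (\<iota> r) =
      (weight_of x + (eps_vec (\<iota> j) + eps_vec (\<iota> n))) (\<iota> r)"
    using r by (simp add: weight_of_at eps_vec_def unit_vec_def del: One_nat_def)
next
  fix i assume i: "i \<notin> \<iota> ` {1..k}"
  then have "i \<noteq> \<iota> j" "i \<noteq> \<iota> n" using assms by blast+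
  then show "weight_of (x + unit_vec j + unit_vec n) i =
      (weight_of x + (eps_vec (\<iota> j) + eps_vec (\<iota> n))) i"
    using i by (simp add: weight_of_off eps_vec_def del: One_nat_def)
qed

text \<open>Dominance at \<open>\<iota> r\<close> says \<open>x r \<ge> 0\<close>, dominance at
  \<open>\<iota> r - 1\<close> is the upper bound \<open>m r\<close> (absent for
  \<open>\<iota> r = 1\<close>), and all other inequalities are those of \<open>lam\<close>.\<close>

lemma weight_of_dominant_iff:
  assumes "\<And>i. i \<notin> {1..k} \<Longrightarrow> x i = 0"
  shows "weight_of x \<in> dominant_weights l \<longleftrightarrow> x \<in> Xi_verts k m"
proof -
  have bound: "enat (x r) \<le> m r \<longleftrightarrow> \<iota> r = 1 \<or> int (x r) \<le> lam (\<iota> r - 1) - lam (Suc (\<iota> r))"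
    if "r \<in> {1..k}" for r
    using that m le_coroot_val_ext_sum_iff[OF lam iota_in] by simp
  show ?thesis
  proof
    assume dom: "weight_of x \<in> dominant_weights l"
    have "enat (x r) \<le> m r" if r: "r \<in> {1..k}" for r
    proof (cases "\<iota> r = 1")
      case False
      then have p: "\<iota> r - 1 \<in> {1..l}" "Suc (\<iota> r - 1) = \<iota> r" using iota_in[OF r] by auto
      then have "\<iota> r - 1 \<notin> \<iota> ` {1..k}" using gap[of "\<iota> r - 1"] r by fastforce
      moreover have "weight_of x (\<iota> r) \<le> weight_of x (\<iota> r - 1)"
        using dom p unfolding dominant_weights_iff by metis
      ultimately show ?thesis using r by (simp add: bound weight_of_off weight_of_at del: One_nat_def)
    qed (use bound[OF r] in simp)
    then show "x \<in> Xi_verts k m" using assms by (simp add: Xi_verts_def)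
  next
    assume x: "x \<in> Xi_verts k m"
    have "weight_of x (Suc p) \<le> weight_of x p" if p: "p \<in> {1..l}" for p
    proof (cases "p \<in> \<iota> ` {1..k}")
      case True
      then show ?thesis using gap weight_of_at weight_of_off by fastforce
    next
      case p_off: False
      show ?thesis
      proof (cases "Suc p \<in> \<iota> ` {1..k}")
        case True
        then obtain r where r: "r \<in> {1..k}" "\<iota> r = Suc p" by force
        then have "enat (x r) \<le> m r" using x by (simp add: Xi_verts_def)
        then have "int (x r) \<le> lam p - lam (Suc (\<iota> r))" using r p bound by simp
        then show ?thesis using weight_of_at[OF r(1)] weight_of_off[OF p_off] r(2) by simp
      next
        case False
        then show ?thesis using p_off p lam by (simp add: weight_of_off dominant_weights_iff)
      qed
    qed
    moreover have "weight_of x p = 0" if "p \<notin> {1..l}" for p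
    proof -
      have "p \<notin> \<iota> ` {1..k}" using that range by blast
      then show ?thesis using that lam by (simp add: weight_of_off dominant_weights_iff del: One_nat_def)
    qed
    ultimately show "weight_of x \<in> dominant_weights l" by (simp add: dominant_weights_iff)
  qed
qed

section \<open>Matching vertices and arrows through \<open>weight_of\<close>\<close>

lemma weight_of_Xi_verts:
  "weight_of ` Xi_verts k m = {v \<in> dominant_weights l. \<forall>j. j \<notin> \<iota> ` {1..k} \<longrightarrow> v j = lam j}"
proof (intro equalityI subsetI)
  fix v assume "v \<in> weight_of ` Xi_verts k m"
  then show "v \<in> {v \<in> dominant_weights l. \<forall>j. j \<notin> \<iota> ` {1..k} \<longrightarrow> v j = lam j}"
    using weight_of_dominant_iff weight_of_off by (auto simp: Xi_verts_def)
next
  fix v assume "v \<in> {v \<in> dominant_weights l. \<forall>j. j \<notin> \<iota> ` {1..k} \<longrightarrow> v j = lam j}"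
  then have dom: "v \<in> dominant_weights l" and off: "\<And>j. j \<notin> \<iota> ` {1..k} \<Longrightarrow> v j = lam j" by auto
  \<comment> \<open>The entries are the values of \<open>v\<close> at the chosen coroots, because
    \<open>v\<close> and \<open>lam\<close> agree at \<open>Suc (\<iota> r)\<close>;
    \<open>nat\<close> loses nothing as \<open>v\<close> is dominant.\<close>
  define x where "x r = (if r \<in> {1..k} then nat (v (\<iota> r) - lam (Suc (\<iota> r))) else 0)" for r
  have "weight_of x = v"
  proof (rule weight_eqI)
    fix r assume r: "r \<in> {1..k}"
    have "v (Suc (\<iota> r)) \<le> v (\<iota> r)" using dom iota_in[OF r] by (simp add: dominant_weights_iff)
    moreover have "v (Suc (\<iota> r)) = lam (Suc (\<iota> r))" using r gap off by blast
    ultimately show "weight_of x (\<iota> r) = v (\<iota> r)" using r by (simp add: weight_of_at x_def)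
  qed (simp add: off weight_of_off)
  moreover from this have "x \<in> Xi_verts k m"
    using dom weight_of_dominant_iff[of x] unfolding x_def by (metis (full_types))
  ultimately show "v \<in> weight_of ` Xi_verts k m" by blast
qed

lemma inj_on_weight_of: "inj_on weight_of (Xi_verts k m)"
  by (rule inj_onI, rule weight_of_inj) (auto simp: Xi_verts_def)

text \<open>On both sides the arrows are all moves by two units that stay among the vertices, and
  \<open>weight_of_add\<close> with injectivity matches these moves.\<close>

lemma Delta_arc_weight_of_iff:
  assumes "x \<in> Xi_verts k m" "y \<in> Xi_verts k m"
  shows "(weight_of y, weight_of x) \<in> arcs (Delta l (Psi l k \<iota>)) \<longleftrightarrow> (y, x) \<in> arcs (Xi k m)"
proof -
  have dom: "weight_of x \<in> dominant_weights l" "weight_of y \<in> dominant_weights l"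
    using assms weight_of_Xi_verts by blast+
  have "weight_of y = weight_of x + (eps_vec (\<iota> j) + eps_vec (\<iota> n)) \<longleftrightarrow> y = x + unit_vec j + unit_vec n"
    if "j \<in> {1..k}" "n \<in> {1..k}" for j n
  proof -
    have "y i = (x + unit_vec j + unit_vec n) i" if "i \<notin> {1..k}" for i
    proof -
      have "i \<noteq> j" "i \<noteq> n" using that \<open>j \<in> {1..k}\<close> \<open>n \<in> {1..k}\<close> by blast+
      then show ?thesis using that assms unfolding Xi_verts_def by (simp add: unit_vec_def del: One_nat_def)
    qed
    then show ?thesis
      unfolding weight_of_add[OF that, symmetric] using weight_of_inj[of y] by blast
  qed
  then show ?thesis
    unfolding Delta_arc_iff_dominant Xi_arc_iff using assms dom by blast
qed

text \<open>An arrow leaves the coordinates outside the chosen indices fixed, and these decide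
  whether a dominant weight lies in the image.\<close>

lemma Delta_arc_closed:
  assumes "(w, v) \<in> arcs (Delta l (Psi l k \<iota>))"
  shows "w \<in> weight_of ` Xi_verts k m \<longleftrightarrow> v \<in> weight_of ` Xi_verts k m"
proof -
  obtain i j where ij: "i \<in> \<iota> ` {1..k}" "j \<in> \<iota> ` {1..k}" "w = v + (eps_vec i + eps_vec j)"
    and dom: "v \<in> dominant_weights l" "w \<in> dominant_weights l"
    using assms unfolding Delta_arc_iff_dominant by blast
  have "w p = v p" if "p \<notin> \<iota> ` {1..k}" for p
  proof -
    have "p \<noteq> i" "p \<noteq> j" using that ij by blast+
    then show ?thesis using ij(3) by (simp add: eps_vec_def)
  qed
  then show ?thesis unfolding weight_of_Xi_verts using dom by auto
qed

lemma digraph_iso_component: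
  assumes a: "a \<in> {0, 1}"
    and cong: "[int a = (\<Sum>r=1..k. coroot_val l lam (\<iota> r))] (mod 2)"
    and nbr: "out_nbrs (Delta l (Psi l k \<iota>)) lam \<union> in_nbrs (Delta l (Psi l k \<iota>)) lam \<noteq> {}"
  shows "digraph_iso (conn_component (Delta l (Psi l k \<iota>)) lam) (Xi_parity k m a)"
proof -
  let ?Q = "Delta l (Psi l k \<iota>)" and ?H = "Xi_parity k m a"
  have sub: "verts ?H \<subseteq> Xi_verts k m" by (auto simp: verts_Xi_parity)
  have arc_H: "(y, x) \<in> arcs ?H \<longleftrightarrow> (y, x) \<in> arcs (Xi k m) \<and> x \<in> verts ?H" for x y
    unfolding Xi_parity_arc_iff Xi_arc_iff using sub by blast
  have arc_verts: "y \<in> verts ?H \<longleftrightarrow> x \<in> verts ?H" if yx: "(y, x) \<in> arcs (Xi k m)" for x y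
  proof -
    obtain j n where "j \<in> {1..k}" "n \<in> {1..k}" "y = x + unit_vec j + unit_vec n"
      "x \<in> Xi_verts k m" "y \<in> Xi_verts k m"
      using yx unfolding Xi_arc_iff by blast
    then show ?thesis
      unfolding verts_Xi_parity by (simp only: mem_Collect_eq parity_add_unit_vecs)
  qed
  \<comment> \<open>Arrows preserve both the image of \<open>Xi_verts\<close> and the parity, so the
    image of the parity class is closed as well.\<close>
  have closed: "w \<in> weight_of ` verts ?H \<longleftrightarrow> v \<in> weight_of ` verts ?H" if wv: "(w, v) \<in> arcs ?Q" for w v
  proof (cases "v \<in> weight_of ` Xi_verts k m")
    case True
    then obtain x y where xy: "x \<in> Xi_verts k m" "y \<in> Xi_verts k m" "v = weight_of x" "w = weight_of y"
      using Delta_arc_closed[OF wv] by blast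
    then have "(y, x) \<in> arcs (Xi k m)" using wv Delta_arc_weight_of_iff by blast
    moreover have "weight_of z \<in> weight_of ` verts ?H \<longleftrightarrow> z \<in> verts ?H" if "z \<in> Xi_verts k m" for z
      using inj_on_image_mem_iff[OF inj_on_weight_of that sub] .
    ultimately show ?thesis using xy arc_verts[of y x] by simp
  next
    case False
    then show ?thesis using Delta_arc_closed[OF wv] sub by blast
  qed
  have "lam \<in> weight_of ` Xi_verts k m" unfolding weight_of_Xi_verts using lam by blast
  then obtain x0 where x0: "x0 \<in> Xi_verts k m" "lam = weight_of x0" by blast
  \<comment> \<open>The preimage \<open>x0\<close> of \<open>lam\<close> has the values of
    \<open>lam\<close> at the chosen coroots as entries, so \<open>a\<close> is its parity.\<close>
  have "int (\<Sum>r=1..k. x0 r) = (\<Sum>r=1..k. coroot_val l lam (\<iota> r))"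
    unfolding of_nat_sum
  proof (rule sum.cong)
    fix r assume r: "r \<in> {1..k}"
    then show "int (x0 r) = coroot_val l lam (\<iota> r)"
      using weight_of_at[OF r, of x0] x0(2) coroot_val_dominant[OF lam iota_in] by simp
  qed simp
  then have "[int (\<Sum>r=1..k. x0 r) = int a] (mod int 2)"
    using cong cong_sym by simp
  then have "[(\<Sum>r=1..k. x0 r) = a] (mod 2)" by (simp only: cong_int_iff)
  with x0 have x0_verts: "x0 \<in> verts ?H" by (simp add: verts_Xi_parity)
  have ends: "tail ?Q = fst" "head ?Q = snd" by (auto simp: Delta_def)
  \<comment> \<open>A neighbour of \<open>lam\<close> yields an arrow inside the image, hence one in
    \<open>?H\<close>; this excludes the exceptional quiver of two isolated vertices.\<close>
  have "\<exists>w v. (w, v) \<in> arcs ?Q \<and> (w = lam \<or> v = lam)"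
    using nbr by (fastforce simp: out_nbrs_def in_nbrs_def arcs_ends_conv ends)
  then obtain w v where wv: "(w, v) \<in> arcs ?Q" "w = lam \<or> v = lam" by blast
  then have "w \<in> weight_of ` verts ?H" "v \<in> weight_of ` verts ?H"
    using closed[OF wv(1)] x0 x0_verts by blast+
  then obtain x y where "x \<in> verts ?H" "y \<in> verts ?H" "v = weight_of x" "w = weight_of y" by blast
  then have "(y, x) \<in> arcs ?H" using wv(1) sub arc_H Delta_arc_weight_of_iff by blast
  then have nonempty: "arcs ?H \<noteq> {}" by blast
  have "digraph_iso (conn_component ?Q (weight_of x0)) ?H"
  proof (rule digraph_iso_conn_component[where f = weight_of, OF wf_Delta wf_Xi_parity ends Xi_parity_ends])
    show "inj_on weight_of (verts ?H)"
      using inj_on_weight_of sub by (rule inj_on_subset)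
    show "weight_of ` verts ?H \<subseteq> verts ?Q"
      using sub weight_of_Xi_verts by (fastforce simp: Delta_def)
    show "(weight_of y, weight_of x) \<in> arcs ?Q \<longleftrightarrow> (y, x) \<in> arcs ?H"
      if "x \<in> verts ?H" "y \<in> verts ?H" for x y
      using that sub arc_H Delta_arc_weight_of_iff by blast
    show "linked ?H x y" if "x \<in> verts ?H" "y \<in> verts ?H" for x y
      by (rule linked_Xi_parity[OF a nonempty that])
  qed (fact closed x0_verts)+
  then show ?thesis unfolding x0(2)[symmetric] .
qed

end

theorem proposition6p4:
  fixes l k a :: nat and \<iota> :: "nat \<Rightarrow> nat" and lam :: weight and m :: "nat \<Rightarrow> enat"
  assumes "2 \<le> l"
    and "1 \<le> k"
    and "strict_mono_on {1..k} \<iota>"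
    and "\<iota> ` {1..k} \<subseteq> {1..l}"
    and "regular_set l (Psi l k \<iota>)"
    and "lam \<in> dominant_weights l"
    and "out_nbrs (Delta l (Psi l k \<iota>)) lam \<union> in_nbrs (Delta l (Psi l k \<iota>)) lam \<noteq> {}"
    and "\<forall>r\<in>{1..k}. m r = coroot_val_ext l lam (\<iota> r - 1) + coroot_val_ext l lam (\<iota> r)"
    and "a \<in> {0, 1}"
    and "[int a = (\<Sum>r=1..k. coroot_val l lam (\<iota> r))] (mod 2)"
  shows "digraph_iso (conn_component (Delta l (Psi l k \<iota>)) lam) (Xi_parity k m a)"
proof -
  \<comment> \<open>This locale comes first because its \<open>regular_set_gap\<close> supplies the
    gap assumption of \<open>type_C_gap\<close>.\<close>
  interpret C: type_C_subset l "\<iota> ` {1..k}" "Psi l k \<iota>"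
    by unfold_locales (fact assms(4), rule Psi_eq[OF assms(4)])
  interpret type_C_gap l k \<iota> lam m
  proof
    show "inj_on \<iota> {1..k}" using assms(3) by (rule strict_mono_on_imp_inj_on)
    show "Suc i \<notin> \<iota> ` {1..k}" if "i \<in> \<iota> ` {1..k}" for i
      using C.regular_set_gap[OF assms(5) that] .
  qed (use assms in auto)
  show ?thesis using assms by (intro digraph_iso_component)
qed

end
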